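(* Let $x\in C^{n+1}\left(\prod_{i=1}^m[a_i,b_i],\mathbb{R}\right)$ with $n\in\mathbb{N}$. Then, for all $k\in\{1,\ldots,m\}$ and all $N\in\mathbb{N}$ with $N\ge n$, and for $\overline t=(t_1,\ldots,t_m)\in\prod_{i=1}^m[a_i,b_i]$ with $t_k>a_k$, we have $$ {}^{C}_{a_k}\mathbb{D}_{t_k}^{\alpha_k(t_k)}x(\overline t)=\sum_{p=1}^{n}A_p\,(t_k-a_k)^{p-\alpha_k(t_k)}\frac{\partial^p x}{\partial t_k^p}[t_k]_k+\sum_{p=n}^{N}B_p\,(t_k-a_k)^{n-p-\alpha_k(t_k)}V_p(\overline t)+E(\overline t), $$ where the approximation error $E(\overline t)$ is bounded by $$ E(\overline t)\le L_{n+1}(\overline t)\,\frac{\exp\left((n-\alpha_k(t_k))^2+n-\alpha_k(t_k)\right)}{\Gamma(n+1-\alpha_k(t_k))\,N^{n-\alpha_k(t_k)}\,(n-\alpha_k(t_k))}\,(t_k-a_k)^{n+1-\alpha_k(t_k)}. $$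
   Context: Let $m\in\mathbb{N}$, $a_i<b_i$ reals, and $\alpha_k:[a_k,b_k]\to(0,1)$, $k\in\{1,\ldots,m\}$, the fractional orders. Given $\overline t=(t_1,\ldots,t_m)$, write $[\tau]_k=(t_1,\ldots,t_{k-1},\tau,t_{k+1},\ldots,t_m)$; $x[\tau]_k$ and $\frac{\partial^p x}{\partial t_k^p}[\tau]_k$ denote the values at this point. The type III partial left Caputo derivative of order $\alpha_k(t_k)$ is $${}^{C}_{a_k}\mathbb{D}_{t_k}^{\alpha_k(t_k)}x(\overline t)=\frac{1}{\Gamma(1-\alpha_k(t_k))}\int_{a_k}^{t_k}(t_k-\tau)^{-\alpha_k(t_k)}\frac{\partial x}{\partial t_k}[\tau]_k\,d\tau.$$ Moreover, $$A_p=\frac{1}{\Gamma(p+1-\alpha_k(t_k))}\left[1+\sum_{l=n-p+1}^N\frac{\Gamma(\alpha_k(t_k)-n+l)}{\Gamma(\alpha_k(t_k)-p)\,(l-n+p)!}\right],$$ $$B_p=\frac{\Gamma(\alpha_k(t_k)-n+p)}{\Gamma(1-\alpha_k(t_k))\Gamma(\alpha_k(t_k))(p-n)!},\qquad V_p(\overline t)=\int_{a_k}^{t_k}(\tau-a_k)^{p-n}\frac{\partial x}{\partial t_k}[\tau]_k\,d\tau,$$ $$L_p(\overline t)=\max_{\tau\in[a_k,t_k]}\left|\frac{\partial^p x}{\partial t_k^p}[\tau]_k\right|.$$ $E(\overline t)$ is the difference between the fractional derivative and the two displayed sums. *)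

theory Defs
  imports "HOL-Analysis.Analysis"
begin

definition upd_coord :: "real ^ 'm \<Rightarrow> 'm \<Rightarrow> real \<Rightarrow> real ^ 'm"
  where "upd_coord t k \<tau> = (\<chi> i. if i = k then \<tau> else t $ i)"

text \<open>
  Partial derivative in the \<open>k\<close>-th coordinate on the box \<open>cbox a b\<close>. It is taken within
  the \<open>k\<close>-th edge, so that it is two-sided at inner points and one-sided on the two faces
  orthogonal to the \<open>k\<close>-th axis.
\<close>

definition partial_on_box ::
    "real ^ 'm \<Rightarrow> real ^ 'm \<Rightarrow> 'm \<Rightarrow> (real ^ 'm \<Rightarrow> real) \<Rightarrow> real ^ 'm \<Rightarrow> real"
  where "partial_on_box a b k f t =
    vector_derivative (\<lambda>s. f (upd_coord t k s)) (at (t $ k) within {a $ k..b $ k})"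

text \<open>
  \<open>C\<^sup>r\<close> on the closed box: all mixed partial derivatives of order at most \<open>r\<close> exist
  (one-sided at the boundary) and are continuous on \<open>cbox a b\<close>.
\<close>

primrec C_on_box :: "nat \<Rightarrow> real ^ 'm \<Rightarrow> real ^ 'm \<Rightarrow> (real ^ 'm \<Rightarrow> real) \<Rightarrow> bool"
  where
    "C_on_box 0 a b f \<longleftrightarrow> continuous_on (cbox a b) f"
  | "C_on_box (Suc r) a b f \<longleftrightarrow>
      continuous_on (cbox a b) f \<and>
      (\<forall>k. (\<forall>t\<in>cbox a b. (\<lambda>s. f (upd_coord t k s)) differentiable
              (at (t $ k) within {a $ k..b $ k})) \<and>
           C_on_box r a b (partial_on_box a b k f))"

definition partial_pow_on_box ::
    "real ^ 'm \<Rightarrow> real ^ 'm \<Rightarrow> 'm \<Rightarrow> nat \<Rightarrow> (real ^ 'm \<Rightarrow> real) \<Rightarrow> real ^ 'm \<Rightarrow> real"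
  where "partial_pow_on_box a b k p f = (partial_on_box a b k ^^ p) f"

definition caputo_III ::
    "real ^ 'm \<Rightarrow> real ^ 'm \<Rightarrow> ('m \<Rightarrow> real \<Rightarrow> real) \<Rightarrow> 'm \<Rightarrow> (real ^ 'm \<Rightarrow> real) \<Rightarrow> real ^ 'm \<Rightarrow> real"
  where "caputo_III a b \<alpha> k x t =
    1 / Gamma (1 - \<alpha> k (t $ k)) *
    integral {a $ k..t $ k}
      (\<lambda>\<tau>. (t $ k - \<tau>) powr (- \<alpha> k (t $ k)) * partial_on_box a b k x (upd_coord t k \<tau>))"

text \<open>
  In the coefficients the real number \<open>al\<close> stands for the value of the order at the evaluation
  point. The natural-number subtractions are exact in the ranges in which the coefficients are
  used: \<open>coeff_A\<close> for \<open>1 \<le> p \<le> n\<close>, \<open>coeff_B\<close> and \<open>moment_V\<close> for \<open>n \<le> p\<close>.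
\<close>

definition coeff_A :: "nat \<Rightarrow> nat \<Rightarrow> real \<Rightarrow> nat \<Rightarrow> real"
  where "coeff_A n N al p =
    1 / Gamma (real p + 1 - al) *
    (1 + (\<Sum>l = n - p + 1..N.
            Gamma (al - real n + real l) / (Gamma (al - real p) * fact (l + p - n))))"

definition coeff_B :: "nat \<Rightarrow> real \<Rightarrow> nat \<Rightarrow> real"
  where "coeff_B n al p =
    Gamma (al - real n + real p) / (Gamma (1 - al) * Gamma al * fact (p - n))"

definition moment_V ::
    "real ^ 'm \<Rightarrow> real ^ 'm \<Rightarrow> 'm \<Rightarrow> (real ^ 'm \<Rightarrow> real) \<Rightarrow> nat \<Rightarrow> nat \<Rightarrow> real ^ 'm \<Rightarrow> real"
  where "moment_V a b k x n p t =
    integral {a $ k..t $ k}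
      (\<lambda>\<tau>. (\<tau> - a $ k) ^ (p - n) * partial_on_box a b k x (upd_coord t k \<tau>))"

text \<open>\<open>GREATEST\<close> is the maximum of the set of values (\<open>Max\<close> is meaningful for finite sets only).\<close>

definition max_L ::
    "real ^ 'm \<Rightarrow> real ^ 'm \<Rightarrow> 'm \<Rightarrow> (real ^ 'm \<Rightarrow> real) \<Rightarrow> nat \<Rightarrow> real ^ 'm \<Rightarrow> real"
  where "max_L a b k x p t =
    (GREATEST y. y \<in> (\<lambda>\<tau>. \<bar>partial_pow_on_box a b k p x (upd_coord t k \<tau>)\<bar>) ` {a $ k..t $ k})"

definition approx_error ::
    "real ^ 'm \<Rightarrow> real ^ 'm \<Rightarrow> ('m \<Rightarrow> real \<Rightarrow> real) \<Rightarrow> 'm \<Rightarrow> (real ^ 'm \<Rightarrow> real) \<Rightarrow> nat \<Rightarrow> nat \<Rightarrow>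
     real ^ 'm \<Rightarrow> real"
  where "approx_error a b \<alpha> k x n N t =
    caputo_III a b \<alpha> k x t -
    ((\<Sum>p = 1..n. coeff_A n N (\<alpha> k (t $ k)) p * (t $ k - a $ k) powr (real p - \<alpha> k (t $ k)) *
                  partial_pow_on_box a b k p x t) +
     (\<Sum>p = n..N. coeff_B n (\<alpha> k (t $ k)) p *
                  (t $ k - a $ k) powr (real n - real p - \<alpha> k (t $ k)) *
                  moment_V a b k x n p t))"

end

theory Submission
  imports Defs
begin

text \<open>
  With \<open>u = a $ k\<close>, \<open>w = t $ k\<close> and \<open>al\<close> the order at \<open>t\<close>, expand \<open>(w - \<tau>) powr (p - al)\<close> by the
  binomial series in powers of \<open>(\<tau> - u) / (w - u)\<close> and let \<open>K p\<close> be the tail beyond the index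
  \<open>N - n + p\<close>, divided by \<open>Gamma (p + 1 - al)\<close>. Then \<open>- K p\<close> is the derivative of \<open>K (p + 1)\<close>,
  \<open>K p\<close> vanishes at \<open>u\<close>, and its value at \<open>w\<close> is the coefficient \<open>- A\<^sub>p\<close> times \<open>(w - u) powr (p - al)\<close>.
  Integrating \<open>K 0\<close> against the first derivative of \<open>x\<close> by parts \<open>n\<close> times therefore shows that the
  approximation error is exactly the integral of \<open>K n\<close> against the derivative of order \<open>n + 1\<close>.

  The binomial coefficients of \<open>\<nu> = n - al\<close> have constant sign from the index \<open>n\<close> on, so \<open>K n\<close> does
  not change sign, and the integral of its absolute value is read off \<open>K (n + 1)\<close>: up to explicit factors
  it is a single coefficient \<open>\<bar>pochhammer (- \<nu>) (N + 1)\<bar> / fact (N + 1)\<close>, which decays like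
  \<open>((n + 1) / (N + 2)) powr (\<nu> + 1)\<close>. The bound follows from \<open>n + 1 \<le> exp (\<nu> + 1)\<close>.
\<close>

section \<open>Sign, summation and decay of generalized binomial coefficients\<close>

text \<open>The hockey-stick identity in rising-factorial form. It collapses both the bracket in
  \<open>coeff_A\<close> and the truncated binomial series at its right end to one quotient.\<close>

lemma sum_pochhammer_over_fact:
  fixes c :: real
  shows "(\<Sum>j\<le>m. pochhammer c j / fact j) = pochhammer (c + 1) m / fact m"
proof (induction m)
  case (Suc m)
  have "pochhammer c (Suc m) = c * pochhammer (c + 1) m"
    by (simp add: pochhammer_rec)
  moreover have "pochhammer (c + 1) (Suc m) = pochhammer (c + 1) m * (c + 1 + real m)"
    by (simp add: pochhammer_Suc)
  ultimately show ?case
    unfolding sum.atMost_Suc Suc.IH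
    by (simp only: fact_Suc) (simp add: divide_simps, simp add: algebra_simps)
qed simp

text \<open>The factors \<open>j - \<nu>\<close> are negative exactly for \<open>j < n\<close>, so
  the sign is settled by the first \<open>n\<close> factors.\<close>

lemma pochhammer_sign:
  fixes \<nu> :: real
  assumes "real n - 1 < \<nu>" "\<nu> < real n" "n \<le> m"
  shows "0 \<le> (- 1) ^ n * pochhammer (- \<nu>) m"
  using \<open>n \<le> m\<close>
proof (induction m rule: dec_induct)
  case base
  have "(- 1) ^ n * pochhammer (- \<nu>) n = pochhammer (\<nu> - real n + 1) n"
    by (simp add: pochhammer_minus flip: power_mult_distrib mult.assoc)
  then show ?case
    using assms by (simp add: pochhammer_nonneg)
next
  case (step m)
  have "(- 1) ^ n * pochhammer (- \<nu>) (Suc m) = ((- 1) ^ n * pochhammer (- \<nu>) m) * (real m - \<nu>)"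
    by (simp add: pochhammer_Suc)
  moreover have "\<nu> \<le> real m"
    using assms step.hyps by linarith
  ultimately show ?case
    using step.IH by (metis diff_ge_0_iff_ge mult_nonneg_nonneg)
qed

text \<open>Passing from \<open>m\<close> to \<open>m + 1\<close> multiplies the left side by
  \<open>1 - (\<nu> + 1) / (m + 1)\<close>, which is at most
  \<open>((m + 1) / (m + 2)) powr (\<nu> + 1)\<close>; these factors telescope. The induction starts
  at \<open>m = n\<close>, where the right side is 1.\<close>

lemma pochhammer_abs_le:
  fixes \<nu> :: real
  assumes "n \<ge> 1" "real n - 1 < \<nu>" "\<nu> < real n" "n \<le> m"
  shows "\<bar>pochhammer (- \<nu>) m\<bar> / fact m \<le> ((real n + 1) / (real m + 1)) powr (\<nu> + 1)"
  using \<open>n \<le> m\<close>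
proof (induction m rule: dec_induct)
  case base
  have "\<bar>pochhammer (- \<nu>) n\<bar> = pochhammer (\<nu> - real n + 1) n"
    using assms by (simp add: pochhammer_minus abs_mult power_abs pochhammer_nonneg)
  \<comment> \<open>Factor by factor, \<open>\<nu> - n + 1 + i \<le> 1 + i\<close>.\<close>
  also have "\<dots> \<le> pochhammer 1 n"
    unfolding pochhammer_prod using assms by (intro prod_mono) auto
  finally show ?case
    by (simp flip: pochhammer_fact)
next
  case (step m)
  let ?r = "\<nu> + 1" and ?y = "real m + 1"
  have \<nu>: "0 < ?r" "\<nu> \<le> real m"
    using assms step.hyps by linarith+
  have "(real m - \<nu>) / ?y = 1 + - (?r * (1 / ?y))"
    by (simp add: field_simps)
  also have "\<dots> \<le> exp (- (?r * (1 / ?y)))"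
    by (rule exp_ge_add_one_self)
  also have "\<dots> \<le> exp (- (?r * ln (1 + 1 / ?y)))"
    using \<nu> by (intro iffD2[OF exp_le_cancel_iff] le_imp_neg_le mult_left_mono ln_add_one_self_le_self) auto
  also have "\<dots> = (1 + 1 / ?y) powr (- ?r)"
    by (auto simp add: powr_def add_nonneg_eq_0_iff) (simp add: algebra_simps)
  also have "\<dots> = (inverse (1 + 1 / ?y)) powr ?r"
    unfolding powr_minus by (simp add: inverse_powr)
  also have "inverse (1 + 1 / ?y) = ?y / (?y + 1)"
    by (simp add: field_simps)
  finally have q: "(real m - \<nu>) / ?y \<le> (?y / (?y + 1)) powr ?r" .
  have "\<bar>pochhammer (- \<nu>) (Suc m)\<bar> / fact (Suc m)
      = (\<bar>pochhammer (- \<nu>) m\<bar> / fact m) * ((real m - \<nu>) / ?y)"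
    using \<nu> by (simp add: pochhammer_Suc abs_mult)
  also have "\<dots> \<le> ((real n + 1) / ?y) powr ?r * (?y / (?y + 1)) powr ?r"
    using \<nu> by (intro mult_mono step.IH q) auto
  also have "\<dots> = ((real n + 1) / ?y * (?y / (?y + 1))) powr ?r"
    by (rule powr_mult[symmetric])
  finally show ?case
    by (simp add: add.commute)
qed

section \<open>Tails of the binomial expansion of the kernel\<close>

text \<open>
  Up to the factor \<open>1 / Gamma (p + 1 - al)\<close>, this is the tail of the binomial expansion of
  \<open>(w - \<tau>) powr (p - al)\<close> in powers of \<open>(\<tau> - u) / (w - u)\<close>.
\<close>

definition binomial_tail :: "nat \<Rightarrow> real \<Rightarrow> real \<Rightarrow> real \<Rightarrow> nat \<Rightarrow> real \<Rightarrow> real"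
  where "binomial_tail M al u w p \<tau> =
    ((w - \<tau>) powr (real p - al) -
     (\<Sum>j\<le>M + p. pochhammer (al - real p) j / fact j *
        (w - u) powr (real p - al - real j) * (\<tau> - u) ^ j)) / Gamma (real p + 1 - al)"

text \<open>Differentiation brings out the factor \<open>-(p + 1 - al)\<close> from the power and
  from every term of the sum, and the normalizing Gamma value absorbs it. The truncation index
  \<open>M + p\<close> drops together with \<open>p\<close>, so no term is left over.\<close>

lemma binomial_tail_deriv:
  assumes "\<tau> < w" "al < 1"
  shows "(binomial_tail M al u w (Suc p) has_real_derivative - binomial_tail M al u w p \<tau>)
    (at \<tau> within S)"
proof -
  let ?h = "w - u" and ?c = "real p + 1 - al"
  define T where "T = (\<Sum>j\<le>M + p. pochhammer (al - real p) j / fact j *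
        ?h powr (real p - al - real j) * (\<tau> - u) ^ j)"
  have c: "?c > 0" using assms by linarith
  have G: "Gamma (real (Suc p) + 1 - al) = ?c * Gamma ?c"
    using c Gamma_plus1[of ?c] by (auto simp: algebra_simps nonpos_Ints_def)
  have G0: "Gamma ?c > 0" using c by (rule Gamma_real_pos)
  have t: "pochhammer (al - real (Suc p)) (Suc j) / fact (Suc j) *
        ?h powr (real (Suc p) - al - real (Suc j)) * (real (Suc j) * (\<tau> - u) ^ j)
      = - ?c * (pochhammer (al - real p) j / fact j * ?h powr (real p - al - real j) * (\<tau> - u) ^ j)" for j
  proof -
    have "pochhammer (al - real (Suc p)) (Suc j) = - ?c * pochhammer (al - real p) j"
      by (simp add: pochhammer_rec algebra_simps)
    moreover have "real (Suc p) - al - real (Suc j) = real p - al - real j" by simp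
    moreover have "(fact (Suc j) :: real) = real (Suc j) * fact j" by (rule fact_Suc)
    ultimately show ?thesis
      by (simp only:) (simp add: field_simps del: of_nat_Suc)
  qed
  have "((\<lambda>s. \<Sum>j\<le>M + Suc p. pochhammer (al - real (Suc p)) j / fact j *
        ?h powr (real (Suc p) - al - real j) * (s - u) ^ j) has_real_derivative
      (\<Sum>j\<le>M + Suc p. pochhammer (al - real (Suc p)) j / fact j *
        ?h powr (real (Suc p) - al - real j) * (real j * (\<tau> - u) ^ (j - 1)))) (at \<tau> within S)"
    by (rule DERIV_sum) (auto intro!: derivative_eq_intros)
  also have "(\<Sum>j\<le>M + Suc p. pochhammer (al - real (Suc p)) j / fact j *
        ?h powr (real (Suc p) - al - real j) * (real j * (\<tau> - u) ^ (j - 1))) = - ?c * T"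
    \<comment> \<open>The constant term \<open>j = 0\<close> is split off; its derivative vanishes
      and the rest shifts down by one index.\<close>
    unfolding add_Suc_right sum.atMost_Suc_shift T_def sum_distrib_left
    by (simp only: t diff_Suc_1 of_nat_0 mult_zero_left mult_zero_right add_0)
  finally have D1: "((\<lambda>s. \<Sum>j\<le>M + Suc p. pochhammer (al - real (Suc p)) j / fact j *
        ?h powr (real (Suc p) - al - real j) * (s - u) ^ j) has_real_derivative - ?c * T)
      (at \<tau> within S)" .
  have "((\<lambda>s. (w - s) powr (real (Suc p) - al)) has_real_derivative - ?c * (w - \<tau>) powr (real p - al))
      (at \<tau> within S)"
    using assms by (auto intro!: derivative_eq_intros simp: algebra_simps)
  from DERIV_cdivide[OF DERIV_diff[OF this D1], of "Gamma (real (Suc p) + 1 - al)"]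
  have "(binomial_tail M al u w (Suc p) has_real_derivative
      (- ?c * (w - \<tau>) powr (real p - al) - - ?c * T) / Gamma (real (Suc p) + 1 - al))
      (at \<tau> within S)"
    unfolding binomial_tail_def .
  moreover have "(- ?c * (w - \<tau>) powr (real p - al) - - ?c * T) / Gamma (real (Suc p) + 1 - al)
      = - binomial_tail M al u w p \<tau>"
    unfolding G binomial_tail_def T_def[symmetric] using c G0
    by (simp add: divide_simps) (simp add: algebra_simps)
  ultimately show ?thesis by simp
qed

text \<open>For \<open>p \<ge> 1\<close> the exponent \<open>p - al\<close> is positive, so the
  power is continuous up to \<open>w\<close>.\<close>

lemma continuous_on_binomial_tail:
  assumes "al < 1" "p \<ge> 1"
  shows "continuous_on {u..w} (binomial_tail M al u w p)"
  unfolding binomial_tail_def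
proof (intro continuous_on_divide continuous_on_diff continuous_on_powr' continuous_intros)
  have "Gamma (real p + 1 - al) > 0"
    using assms by (intro Gamma_real_pos) auto
  then show "\<forall>x\<in>{u..w}. Gamma (real p + 1 - al) \<noteq> 0" by auto
qed (use assms in auto)

lemma binomial_tail_left:
  "binomial_tail M al u w p u = 0"
  by (simp add: binomial_tail_def sum.atMost_shift power_0_left if_distrib)

text \<open>At \<open>w\<close> the power vanishes and all terms of the sum share the factor
  \<open>(w - u) powr (p - al)\<close>; \<open>sum_pochhammer_over_fact\<close> evaluates what
  remains.\<close>

lemma binomial_tail_right:
  assumes "u < w" "al < 1" "p \<ge> 1"
  shows "binomial_tail M al u w p w =
    - ((w - u) powr (real p - al) * pochhammer (al - real p + 1) (M + p) / fact (M + p))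
      / Gamma (real p + 1 - al)"
proof -
  have "(w - u) powr (real p - al - real j) * (w - u) ^ j = (w - u) powr (real p - al)" for j
    using assms by (simp add: powr_diff powr_realpow)
  then have "(\<Sum>j\<le>M + p. pochhammer (al - real p) j / fact j *
        (w - u) powr (real p - al - real j) * (w - u) ^ j)
      = (\<Sum>j\<le>M + p. pochhammer (al - real p) j / fact j) * (w - u) powr (real p - al)"
    by (simp add: sum_distrib_right mult.assoc)
  then show ?thesis
    unfolding binomial_tail_def sum_pochhammer_over_fact
    by simp
qed

text \<open>After scaling by \<open>w - u\<close>, this is the remainder of a convergent binomial
  series in \<open>s < 1\<close>. It involves only indices above \<open>M + n\<close>, where
  \<open>pochhammer_sign\<close> gives all coefficients the same sign.\<close>

lemma binomial_tail_sign:
  assumes "u \<le> \<tau>" "\<tau> < w" "0 < al" "al < 1"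
  shows "0 \<le> (- 1) ^ n * binomial_tail M al u w n \<tau>"
proof -
  define \<nu> where "\<nu> = real n - al"
  define s where "s = (\<tau> - u) / (w - u)"
  define f where "f = (\<lambda>j. pochhammer (- \<nu>) j / fact j * s ^ j)"
  have s: "0 \<le> s" "s < 1" and h: "w - u > 0"
    using assms by (auto simp: s_def)
  have \<nu>: "real n - 1 < \<nu>" "\<nu> < real n"
    using assms by (auto simp: \<nu>_def)
  have "(\<lambda>j. (\<nu> gchoose j) * (- s) ^ j) sums (1 + - s) powr \<nu>"
    using s by (intro gen_binomial_real) auto
  moreover have "(\<nu> gchoose j) * (- s) ^ j = f j" for j
    unfolding f_def gbinomial_pochhammer by (subst power_minus) (simp add: power_mult_distrib[symmetric])
  ultimately have "f sums (1 - s) powr \<nu>" by simp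
  then have "(\<lambda>j. f (j + Suc (M + n))) sums ((1 - s) powr \<nu> - (\<Sum>j<Suc (M + n). f j))"
    by (rule sums_split_initial_segment)
  then have "(\<lambda>j. (- 1) ^ n * f (j + Suc (M + n))) sums
      ((- 1) ^ n * ((1 - s) powr \<nu> - (\<Sum>j\<le>M + n. f j)))"
    by (intro sums_mult) (simp add: lessThan_Suc_atMost)
  from sums_zero this have pos: "0 \<le> (- 1) ^ n * ((1 - s) powr \<nu> - (\<Sum>j\<le>M + n. f j))"
  proof (rule sums_le[rotated])
    fix j
    have "0 \<le> (- 1) ^ n * pochhammer (- \<nu>) (j + Suc (M + n)) *
        (s ^ (j + Suc (M + n)) / fact (j + Suc (M + n)))"
      using s by (intro mult_nonneg_nonneg pochhammer_sign \<nu> divide_nonneg_nonneg) auto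
    then show "0 \<le> (- 1) ^ n * f (j + Suc (M + n))"
      by (simp add: f_def)
  qed
  have "(w - \<tau>) powr \<nu> = (w - u) powr \<nu> * (1 - s) powr \<nu>"
  proof -
    have "w - \<tau> = (w - u) * (1 - s)"
      using h by (simp add: s_def field_simps)
    then show ?thesis by (simp only: powr_mult)
  qed
  moreover have "pochhammer (al - real n) j / fact j * (w - u) powr (real n - al - real j) * (\<tau> - u) ^ j
      = (w - u) powr \<nu> * f j" for j
    using h by (simp add: \<nu>_def s_def f_def powr_diff powr_realpow power_divide mult_ac)
  ultimately have "(- 1) ^ n * binomial_tail M al u w n \<tau> =
      ((- 1) ^ n * ((1 - s) powr \<nu> - (\<Sum>j\<le>M + n. f j))) * ((w - u) powr \<nu> / Gamma (real n + 1 - al))"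
    unfolding binomial_tail_def by (simp add: \<nu>_def algebra_simps sum_distrib_left diff_divide_distrib)
  also have "0 \<le> \<dots>"
    using assms by (intro mult_nonneg_nonneg pos divide_nonneg_pos Gamma_real_pos) auto
  finally show ?thesis .
qed

text \<open>The constant sign lets the absolute value be replaced by a fixed sign, and
  \<open>binomial_tail\<close> at \<open>n + 1\<close> is an antiderivative up to sign that vanishes
  at \<open>u\<close>.\<close>

lemma integral_abs_binomial_tail:
  assumes "u < w" "0 < al" "al < 1" "n \<ge> 1"
  shows "((\<lambda>\<tau>. \<bar>binomial_tail M al u w n \<tau>\<bar>) has_integral
    (w - u) powr (real n + 1 - al) * (\<bar>pochhammer (al - real n) (M + Suc n)\<bar> / fact (M + Suc n))
      / Gamma (real n + 2 - al)) {u..w}"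
proof -
  let ?K = "binomial_tail M al u w"
  have "((\<lambda>\<tau>. - ?K n \<tau>) has_integral ?K (Suc n) w - ?K (Suc n) u) {u..w}"
    using assms
    by (intro fundamental_theorem_of_calculus_interior continuous_on_binomial_tail)
       (auto intro!: binomial_tail_deriv simp flip: has_real_derivative_iff_has_vector_derivative)
  then have I: "((\<lambda>\<tau>. (- 1) ^ Suc n * (- ?K n \<tau>)) has_integral
      (- 1) ^ Suc n * (?K (Suc n) w - ?K (Suc n) u)) {u..w}"
    by (rule has_integral_mult_right)
  have "((\<lambda>\<tau>. \<bar>?K n \<tau>\<bar>) has_integral (- 1) ^ Suc n * (?K (Suc n) w - ?K (Suc n) u)) {u..w}"
  proof (rule has_integral_spike[OF _ _ I])
    \<comment> \<open>The sign is known only for \<open>\<tau> < w\<close>; the endpoint is dropped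
      as a null set.\<close>
    show "negligible {w}" by simp
    show "\<bar>?K n \<tau>\<bar> = (- 1) ^ Suc n * (- ?K n \<tau>)" if "\<tau> \<in> {u..w} - {w}" for \<tau>
    proof -
      have "0 \<le> (- 1) ^ n * ?K n \<tau>"
        using that assms by (intro binomial_tail_sign) auto
      then have "(- 1) ^ n * ?K n \<tau> = \<bar>(- 1) ^ n * ?K n \<tau>\<bar>" by simp
      then show ?thesis by (simp add: abs_mult power_abs)
    qed
  qed
  moreover have "(- 1) ^ Suc n * (?K (Suc n) w - ?K (Suc n) u) =
      (w - u) powr (real n + 1 - al) * (\<bar>pochhammer (al - real n) (M + Suc n)\<bar> / fact (M + Suc n))
      / Gamma (real n + 2 - al)"
  proof -
    have "0 \<le> (- 1) ^ n * pochhammer (- (real n - al)) (M + Suc n)"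
      using assms by (intro pochhammer_sign) auto
    then have "(- 1) ^ n * pochhammer (- (real n - al)) (M + Suc n)
        = \<bar>(- 1) ^ n * pochhammer (- (real n - al)) (M + Suc n)\<bar>"
      by simp
    then have "(- 1) ^ n * pochhammer (al - real n) (M + Suc n) = \<bar>pochhammer (al - real n) (M + Suc n)\<bar>"
      by (simp add: abs_mult power_abs)
    moreover have e: "al - real (Suc n) + 1 = al - real n" "real (Suc n) - al = real n + 1 - al"
      "real (Suc n) + 1 - al = real n + 2 - al" by simp_all
    have "1 \<le> Suc n" by simp
    from binomial_tail_right[OF assms(1,3) this, of M, unfolded e]
    have "?K (Suc n) w = - ((w - u) powr (real n + 1 - al) *
        pochhammer (al - real n) (M + Suc n) / fact (M + Suc n)) / Gamma (real n + 2 - al)"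
      .
    ultimately show ?thesis
      by (simp add: binomial_tail_left del: add_Suc_right fact_Suc)
  qed
  ultimately show ?thesis by simp
qed

text \<open>All \<open>n\<close> integrations by parts are done at once. The tail with
  \<open>p = 0\<close> may be unbounded near \<open>w\<close>, so its integrability against
  \<open>F 1\<close> is derived, from the fundamental theorem with derivatives at interior points
  only.\<close>

lemma binomial_tail_by_parts:
  fixes F :: "nat \<Rightarrow> real \<Rightarrow> real"
  assumes "u < w" "al < 1" "n \<ge> 1"
    and F: "\<And>p \<tau>. p \<le> n \<Longrightarrow> \<tau> \<in> {u..w} \<Longrightarrow>
      (F p has_real_derivative F (Suc p) \<tau>) (at \<tau> within {u..w})"
    and cont: "continuous_on {u..w} (F (Suc n))"
  shows "((\<lambda>\<tau>. binomial_tail M al u w 0 \<tau> * F 1 \<tau>) has_integral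
      integral {u..w} (\<lambda>\<tau>. binomial_tail M al u w n \<tau> * F (Suc n) \<tau>) -
      (\<Sum>p = 1..n. binomial_tail M al u w p w * F p w)) {u..w}"
proof -
  let ?K = "binomial_tail M al u w"
  \<comment> \<open>\<open>G\<close> collects all boundary terms; its derivative telescopes.\<close>
  define G where "G = (\<lambda>\<tau>. \<Sum>q<n. ?K (Suc q) \<tau> * F (Suc q) \<tau>)"
  have contF: "continuous_on {u..w} (F p)" if "p \<le> n" for p
    using F[OF that] by (meson DERIV_continuous continuous_on_eq_continuous_within)
  have "continuous_on {u..w} G"
    unfolding G_def by (intro continuous_intros continuous_on_binomial_tail contF) (use assms in auto)
  moreover have "(G has_vector_derivative ?K n \<tau> * F (Suc n) \<tau> - ?K 0 \<tau> * F 1 \<tau>) (at \<tau>)"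
    if \<tau>: "\<tau> \<in> {u<..<w}" for \<tau>
  proof -
    have "(G has_real_derivative
        (\<Sum>q<n. ?K (Suc q) \<tau> * F (Suc (Suc q)) \<tau> - ?K q \<tau> * F (Suc q) \<tau>)) (at \<tau>)"
      unfolding G_def
    proof (rule DERIV_sum)
      fix q assume "q \<in> {..<n}"
      then have "(F (Suc q) has_real_derivative F (Suc (Suc q)) \<tau>) (at \<tau> within {u..w})"
        using \<tau> by (intro F) auto
      then have "(F (Suc q) has_real_derivative F (Suc (Suc q)) \<tau>) (at \<tau>)"
        using \<tau> by (simp add: at_within_Icc_at)
      from DERIV_mult[OF binomial_tail_deriv this]
      show "((\<lambda>\<tau>. ?K (Suc q) \<tau> * F (Suc q) \<tau>) has_real_derivative
          ?K (Suc q) \<tau> * F (Suc (Suc q)) \<tau> - ?K q \<tau> * F (Suc q) \<tau>) (at \<tau>)"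
        using \<tau> assms by (simp add: algebra_simps)
    qed
    also have "(\<Sum>q<n. ?K (Suc q) \<tau> * F (Suc (Suc q)) \<tau> - ?K q \<tau> * F (Suc q) \<tau>) =
        ?K n \<tau> * F (Suc n) \<tau> - ?K 0 \<tau> * F 1 \<tau>"
      using sum_lessThan_telescope[of "\<lambda>q. ?K q \<tau> * F (Suc q) \<tau>" n] by simp
    finally show ?thesis
      by (simp add: has_real_derivative_iff_has_vector_derivative)
  qed
  ultimately have "((\<lambda>\<tau>. ?K n \<tau> * F (Suc n) \<tau> - ?K 0 \<tau> * F 1 \<tau>) has_integral G w - G u) {u..w}"
    using assms by (intro fundamental_theorem_of_calculus_interior) auto
  moreover have "((\<lambda>\<tau>. ?K n \<tau> * F (Suc n) \<tau>) has_integral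
      integral {u..w} (\<lambda>\<tau>. ?K n \<tau> * F (Suc n) \<tau>)) {u..w}"
    by (intro integrable_integral integrable_continuous_interval continuous_on_mult
        continuous_on_binomial_tail cont) (use assms in auto)
  ultimately have "((\<lambda>\<tau>. ?K n \<tau> * F (Suc n) \<tau> - (?K n \<tau> * F (Suc n) \<tau> - ?K 0 \<tau> * F 1 \<tau>)) has_integral
      integral {u..w} (\<lambda>\<tau>. ?K n \<tau> * F (Suc n) \<tau>) - (G w - G u)) {u..w}"
    by (rule has_integral_diff[rotated])
  moreover have "G u = 0" by (simp add: G_def binomial_tail_left)
  moreover have "G w = (\<Sum>p = 1..n. ?K p w * F p w)"
    by (simp add: G_def sum.atLeast1_atMost_eq)
  ultimately show ?thesis by simp
qed

section \<open>The coefficients as Pochhammer quotients, and the expansion with exact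
  remainder\<close>

text \<open>Keeps Gamma arguments off the poles, where \<open>Gamma\<close> has the default value 0,
  so that Gamma quotients are Pochhammer symbols.\<close>

lemma order_diff_notin_nonpos_Ints:
  fixes al :: real
  assumes "0 < al" "al < 1"
  shows "al - real p \<notin> \<int>\<^sub>\<le>\<^sub>0"
proof
  assume "al - real p \<in> \<int>\<^sub>\<le>\<^sub>0"
  then obtain m where "al - real p = of_int m"
    by (auto elim: nonpos_Ints_cases)
  then have "al = of_int (m + int p)" by simp
  with assms have "0 < m + int p" "m + int p < 1" by linarith+
  then show False by simp
qed

text \<open>With \<open>l = j + (n - p)\<close> the summands become
  \<open>pochhammer (al - p) j / fact j\<close>, the leading 1 is the term \<open>j = 0\<close>, and
  the sum collapses.\<close>

lemma coeff_A_eq_pochhammer: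
  assumes "0 < al" "al < 1" "p \<le> n"
  shows "coeff_A n (M + n) al p =
    pochhammer (al - real p + 1) (M + p) / fact (M + p) / Gamma (real p + 1 - al)"
proof -
  let ?g = "\<lambda>l. Gamma (al - real n + real l) / (Gamma (al - real p) * fact (l + p - n))"
  let ?c = "\<lambda>j. pochhammer (al - real p) j / fact j"
  have g: "?g (j + (n - p)) = ?c j" for j
    using assms by (simp add: pochhammer_Gamma[OF order_diff_notin_nonpos_Ints] of_nat_diff algebra_simps)
  have "sum ?g {n - p + 1..M + n} = sum ?g {1 + (n - p)..(M + p) + (n - p)}"
    using assms by simp
  also have "\<dots> = (\<Sum>j = 1..M + p. ?c j)"
    unfolding sum.shift_bounds_cl_nat_ivl g ..
  finally have "1 + sum ?g {n - p + 1..M + n} = (\<Sum>j\<le>M + p. ?c j)"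
    by (simp add: sum.atMost_shift sum.atLeast1_atMost_eq)
  then show ?thesis
    by (simp add: coeff_A_def sum_pochhammer_over_fact)
qed

lemma coeff_B_eq_pochhammer:
  assumes "0 < al" "al < 1"
  shows "coeff_B n al (j + n) = pochhammer al j / fact j / Gamma (1 - al)"
  using pochhammer_Gamma[OF order_diff_notin_nonpos_Ints[OF assms, of 0], of j]
  by (simp add: coeff_B_def algebra_simps)

text \<open>The kernel is split into its binomial sum up to index \<open>N - n\<close>, which yields
  the moments with the coefficients \<open>coeff_B\<close>, and the tail, which is integrated by
  parts. \<open>F p\<close> stands for the derivative of order \<open>p\<close> along the
  edge.\<close>

lemma caputo_expansion:
  fixes F :: "nat \<Rightarrow> real \<Rightarrow> real"
  assumes "u < w" "0 < al" "al < 1" "n \<ge> 1" "n \<le> N"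
    and F: "\<And>p \<tau>. p \<le> n \<Longrightarrow> \<tau> \<in> {u..w} \<Longrightarrow>
      (F p has_real_derivative F (Suc p) \<tau>) (at \<tau> within {u..w})"
    and cont: "continuous_on {u..w} (F (Suc n))"
  shows "1 / Gamma (1 - al) * integral {u..w} (\<lambda>\<tau>. (w - \<tau>) powr (- al) * F 1 \<tau>) =
    (\<Sum>p = 1..n. coeff_A n N al p * (w - u) powr (real p - al) * F p w) +
    (\<Sum>p = n..N. coeff_B n al p * (w - u) powr (real n - real p - al) *
       integral {u..w} (\<lambda>\<tau>. (\<tau> - u) ^ (p - n) * F 1 \<tau>)) +
    integral {u..w} (\<lambda>\<tau>. binomial_tail (N - n) al u w n \<tau> * F (Suc n) \<tau>)"
proof -
  define M where "M = N - n"
  have N: "N = M + n" using assms by (simp add: M_def)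
  let ?K = "binomial_tail M al u w"
  let ?B = "\<lambda>p. coeff_B n al p * (w - u) powr (real n - real p - al)"
  define J where "J = integral {u..w} (\<lambda>\<tau>. ?K n \<tau> * F (Suc n) \<tau>)"
  have contF: "continuous_on {u..w} (F 1)"
    using F[of 1] assms by (meson DERIV_continuous continuous_on_eq_continuous_within)
  have A: "- (?K p w * F p w) = coeff_A n N al p * (w - u) powr (real p - al) * F p w"
    if "p \<in> {1..n}" for p
    using that assms by (simp add: N binomial_tail_right coeff_A_eq_pochhammer mult_ac)
  have "((\<lambda>\<tau>. \<Sum>j\<le>M. ?B (j + n) * ((\<tau> - u) ^ j * F 1 \<tau>)) has_integral
      (\<Sum>j\<le>M. ?B (j + n) * integral {u..w} (\<lambda>\<tau>. (\<tau> - u) ^ j * F 1 \<tau>))) {u..w}"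
    by (intro has_integral_sum has_integral_mult_right integrable_integral
        integrable_continuous_interval continuous_intros contF) auto
  from has_integral_add[OF binomial_tail_by_parts[OF assms(1,3,4) F cont, of M] this]
  have I: "((\<lambda>\<tau>. ?K 0 \<tau> * F 1 \<tau> + (\<Sum>j\<le>M. ?B (j + n) * ((\<tau> - u) ^ j * F 1 \<tau>))) has_integral
      J - (\<Sum>p = 1..n. ?K p w * F p w) +
      (\<Sum>j\<le>M. ?B (j + n) * integral {u..w} (\<lambda>\<tau>. (\<tau> - u) ^ j * F 1 \<tau>))) {u..w}"
    unfolding J_def .
  \<comment> \<open>The \<open>coeff_B\<close> terms are exactly those subtracted in the tail with
    \<open>p = 0\<close>, so adding them restores the kernel.\<close>
  have integrand: "?K 0 \<tau> * F 1 \<tau> + (\<Sum>j\<le>M. ?B (j + n) * ((\<tau> - u) ^ j * F 1 \<tau>)) =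
      1 / Gamma (1 - al) * ((w - \<tau>) powr (- al) * F 1 \<tau>)" for \<tau>
  proof -
    define Q where "Q = (\<lambda>j. pochhammer al j / fact j * (w - u) powr (- al - real j) * (\<tau> - u) ^ j)"
    have "?B (j + n) * ((\<tau> - u) ^ j * F 1 \<tau>) = Q j * (F 1 \<tau> / Gamma (1 - al))" for j
      unfolding coeff_B_eq_pochhammer[OF assms(2,3)] Q_def
      by (simp add: field_simps minus_diff_commute)
    then have sumQ: "(\<Sum>j\<le>M. ?B (j + n) * ((\<tau> - u) ^ j * F 1 \<tau>)) = sum Q {..M} * (F 1 \<tau> / Gamma (1 - al))"
      by (simp only: sum_distrib_right)
    have K0: "?K 0 \<tau> = ((w - \<tau>) powr (- al) - sum Q {..M}) / Gamma (1 - al)"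
      by (simp add: binomial_tail_def Q_def)
    show ?thesis
      unfolding sumQ K0 by (simp add: diff_divide_distrib left_diff_distrib)
  qed
  have "(\<Sum>p = 1..n. - (?K p w * F p w)) =
      (\<Sum>p = 1..n. coeff_A n N al p * (w - u) powr (real p - al) * F p w)"
    by (rule sum.cong[OF refl A])
  then have sumA: "(\<Sum>p = 1..n. ?K p w * F p w) =
      - (\<Sum>p = 1..n. coeff_A n N al p * (w - u) powr (real p - al) * F p w)"
    unfolding sum_negf by linarith
  have sumB: "(\<Sum>j\<le>M. ?B (j + n) * integral {u..w} (\<lambda>\<tau>. (\<tau> - u) ^ j * F 1 \<tau>)) =
      (\<Sum>p = n..N. ?B p * integral {u..w} (\<lambda>\<tau>. (\<tau> - u) ^ (p - n) * F 1 \<tau>))"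
    using sum.shift_bounds_cl_nat_ivl[of "\<lambda>p. ?B p * integral {u..w} (\<lambda>\<tau>. (\<tau> - u) ^ (p - n) * F 1 \<tau>)" 0 n M]
    by (simp add: N atLeast0AtMost)
  have "1 / Gamma (1 - al) * integral {u..w} (\<lambda>\<tau>. (w - \<tau>) powr (- al) * F 1 \<tau>) =
      integral {u..w} (\<lambda>\<tau>. 1 / Gamma (1 - al) * ((w - \<tau>) powr (- al) * F 1 \<tau>))"
    by (rule integral_mult_right[symmetric])
  also note integral_unique[OF I, unfolded integrand sumA sumB]
  finally show ?thesis
    by (simp add: J_def M_def)
qed

section \<open>Estimate of the remainder\<close>

lemma caputo_remainder_bound:
  assumes "u < w" "0 < al" "al < 1" "n \<ge> 1" "n \<le> N"
    and cont: "continuous_on {u..w} f"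
    and L: "\<And>\<tau>. \<tau> \<in> {u..w} \<Longrightarrow> \<bar>f \<tau>\<bar> \<le> L"
  shows "\<bar>integral {u..w} (\<lambda>\<tau>. binomial_tail (N - n) al u w n \<tau> * f \<tau>)\<bar> \<le>
    L * (exp ((real n - al) ^ 2 + real n - al) /
       (Gamma (real n + 1 - al) * real N powr (real n - al) * (real n - al))) *
      (w - u) powr (real n + 1 - al)"
proof -
  define \<nu> where "\<nu> = real n - al"
  define K where "K = binomial_tail (N - n) al u w n"
  define X where "X = \<bar>pochhammer (- \<nu>) (Suc N)\<bar> / fact (Suc N)"
  have \<nu>: "0 < \<nu>" "real n - 1 < \<nu>" "\<nu> < real n" and N: "real N > 0"
    using assms by (auto simp: \<nu>_def)
  have \<nu>_eq: "real n + 1 - al = \<nu> + 1" "real n + 2 - al = \<nu> + 2" "al - real n = - \<nu>"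
    by (simp_all add: \<nu>_def)
  have L0: "0 \<le> L" using L[of u] assms by fastforce
  have G: "Gamma (\<nu> + 2) = (\<nu> + 1) * Gamma (\<nu> + 1)"
    using \<nu> Gamma_plus1[of "\<nu> + 1"] by (auto simp: add.assoc nonpos_Ints_def)
  have G0: "Gamma (\<nu> + 1) > 0" using \<nu> by (intro Gamma_real_pos) auto
  have contK: "continuous_on {u..w} K"
    unfolding K_def using assms by (intro continuous_on_binomial_tail)
  have IK: "((\<lambda>\<tau>. \<bar>K \<tau>\<bar>) has_integral (w - u) powr (\<nu> + 1) * X / Gamma (\<nu> + 2)) {u..w}"
    using integral_abs_binomial_tail[OF assms(1-4), of "N - n"] \<open>n \<le> N\<close>
    unfolding \<nu>_eq by (simp add: K_def X_def del: fact_Suc)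
  have "\<bar>integral {u..w} (\<lambda>\<tau>. K \<tau> * f \<tau>)\<bar> \<le> integral {u..w} (\<lambda>\<tau>. \<bar>K \<tau>\<bar> * L)"
    unfolding real_norm_def[symmetric]
  proof (rule integral_norm_bound_integral)
    show "(\<lambda>\<tau>. K \<tau> * f \<tau>) integrable_on {u..w}"
      by (intro integrable_continuous_interval continuous_intros contK cont)
    show "(\<lambda>\<tau>. norm (K \<tau>) * L) integrable_on {u..w}"
      by (intro integrable_continuous_interval continuous_intros contK)
    show "norm (K \<tau> * f \<tau>) \<le> norm (K \<tau>) * L" if "\<tau> \<in> {u..w}" for \<tau>
      using L[OF that] by (simp add: abs_mult mult_left_mono)
  qed
  also have "\<dots> = L * (w - u) powr (\<nu> + 1) / Gamma (\<nu> + 1) * (X / (\<nu> + 1))"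
    using integral_unique[OF has_integral_mult_left[OF IK, of L]] by (simp add: G mult_ac)
  \<comment> \<open>The factor \<open>\<nu> + 1\<close> from \<open>Gamma (\<nu> + 2)\<close> is
    weakened to \<open>\<nu>\<close>, which gives the factor \<open>n - al\<close> in the
    denominator of the bound.\<close>
  also have "\<dots> \<le> L * (w - u) powr (\<nu> + 1) / Gamma (\<nu> + 1) * (exp (\<nu> ^ 2 + \<nu>) / real N powr \<nu> / \<nu>)"
  proof (intro mult_left_mono frac_le)
    have "X \<le> ((real n + 1) / (real (Suc N) + 1)) powr (\<nu> + 1)"
      unfolding X_def using assms \<nu> by (intro pochhammer_abs_le) auto
    \<comment> \<open>The base is at most 1 because \<open>n \<le> N\<close>, so lowering the
      exponent can only increase the power.\<close>
    also have "\<dots> \<le> ((real n + 1) / (real (Suc N) + 1)) powr \<nu>"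
      using assms by (intro powr_mono') (auto simp: divide_simps)
    also have "\<dots> \<le> ((real n + 1) / real N) powr \<nu>"
      using N \<nu> by (intro powr_mono2 frac_le) auto
    \<comment> \<open>Source of the exponential: \<open>\<nu> > n - 1\<close> gives
      \<open>n + 1 \<le> \<nu> + 2 \<le> exp (\<nu> + 1)\<close>, and raising to the power
      \<open>\<nu>\<close> produces the exponent \<open>\<nu> ^ 2 + \<nu>\<close>.\<close>
    also have "\<dots> \<le> (exp (\<nu> + 1) / real N) powr \<nu>"
    proof (intro powr_mono2 divide_right_mono)
      have "real n + 1 \<le> 1 + (\<nu> + 1)" using \<nu> by simp
      also have "\<dots> \<le> exp (\<nu> + 1)" by (rule exp_ge_add_one_self)
      finally show "real n + 1 \<le> exp (\<nu> + 1)" .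
    qed (use \<nu> N in auto)
    also have "\<dots> = exp (\<nu> ^ 2 + \<nu>) / real N powr \<nu>"
      using N by (simp add: powr_divide exp_powr_real power2_eq_square algebra_simps)
    finally show "X \<le> exp (\<nu> ^ 2 + \<nu>) / real N powr \<nu>" .
  qed (use \<nu> L0 G0 in auto)
  also have "\<dots> = L * (exp ((real n - al) ^ 2 + real n - al) /
       (Gamma (real n + 1 - al) * real N powr (real n - al) * (real n - al))) *
      (w - u) powr (real n + 1 - al)"
    by (simp add: \<nu>_def algebra_simps)
  finally show ?thesis unfolding K_def .
qed

section \<open>Restriction of functions on the box to one edge direction\<close>

lemma upd_coord_nth [simp]: "upd_coord t k \<tau> $ k = \<tau>"
  and upd_coord_upd_coord [simp]: "upd_coord (upd_coord t k \<tau>) k s = upd_coord t k s"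
  and upd_coord_same [simp]: "upd_coord t k (t $ k) = t"
  by (simp_all add: upd_coord_def vec_eq_iff)

lemma upd_coord_mem_cbox:
  assumes "t \<in> cbox a b" "\<tau> \<in> {a $ k..b $ k}"
  shows "upd_coord t k \<tau> \<in> cbox a b"
  using assms by (auto simp: upd_coord_def mem_box_cart)

lemma continuous_on_upd_coord: "continuous_on S (upd_coord t k)"
proof -
  have "continuous_on S (\<lambda>\<tau>. if i = k then \<tau> else t $ i)" for i
    by (cases "i = k") auto
  then show ?thesis
    unfolding upd_coord_def[abs_def] by (rule continuous_on_vec_lambda)
qed

lemma C_on_box_partial_pow:
  assumes "C_on_box r a b f" "p \<le> r"
  shows "C_on_box (r - p) a b (partial_pow_on_box a b k p f)"
  using \<open>p \<le> r\<close>
proof (induction p)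
  case 0
  then show ?case using assms by (simp add: partial_pow_on_box_def)
next
  case (Suc p)
  then have "C_on_box (Suc (r - Suc p)) a b (partial_pow_on_box a b k p f)"
    by (simp add: Suc_diff_Suc)
  then show ?case
    by (simp add: partial_pow_on_box_def)
qed

text \<open>Moving the base point to \<open>upd_coord t k \<tau>\<close> leaves the line in
  direction \<open>k\<close> unchanged, so differentiability at that box point is differentiability
  of the one-variable function at \<open>\<tau>\<close>.\<close>

lemma partial_pow_on_box_deriv:
  assumes "C_on_box r a b f" "p < r" "t \<in> cbox a b" "\<tau> \<in> {a $ k..b $ k}"
  shows "((\<lambda>s. partial_pow_on_box a b k p f (upd_coord t k s)) has_real_derivative
    partial_pow_on_box a b k (Suc p) f (upd_coord t k \<tau>)) (at \<tau> within {a $ k..b $ k})"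
proof -
  let ?g = "partial_pow_on_box a b k p f"
  have "C_on_box (Suc (r - Suc p)) a b ?g"
    using C_on_box_partial_pow[OF assms(1), of p k] assms(2) by (simp add: Suc_diff_Suc)
  then have "(\<lambda>s. ?g (upd_coord (upd_coord t k \<tau>) k s)) differentiable
      (at (upd_coord t k \<tau> $ k) within {a $ k..b $ k})"
    unfolding C_on_box.simps using upd_coord_mem_cbox[OF assms(3,4)] by blast
  then show ?thesis
    by (simp add: vector_derivative_works has_real_derivative_iff_has_vector_derivative
        partial_pow_on_box_def partial_on_box_def)
qed

lemma continuous_on_partial_pow_on_box:
  assumes "C_on_box r a b f" "p \<le> r" "t \<in> cbox a b"
  shows "continuous_on {a $ k..b $ k} (\<lambda>\<tau>. partial_pow_on_box a b k p f (upd_coord t k \<tau>))"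
proof (rule continuous_on_compose2[OF _ continuous_on_upd_coord])
  have "C_on_box (r - p) a b (partial_pow_on_box a b k p f)"
    using assms by (intro C_on_box_partial_pow)
  then show "continuous_on (cbox a b) (partial_pow_on_box a b k p f)"
    by (cases "r - p") auto
qed (use upd_coord_mem_cbox[OF assms(3)] in auto)

text \<open>Continuity on a compact interval makes the supremum attained; only then does
  \<open>GREATEST\<close> denote the maximum.\<close>

lemma abs_le_max_L:
  assumes "C_on_box r a b f" "p \<le> r" "t \<in> cbox a b" "\<tau> \<in> {a $ k..t $ k}"
  shows "\<bar>partial_pow_on_box a b k p f (upd_coord t k \<tau>)\<bar> \<le> max_L a b k f p t"
proof -
  let ?g = "\<lambda>\<tau>. \<bar>partial_pow_on_box a b k p f (upd_coord t k \<tau>)\<bar>"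
  have "{a $ k..t $ k} \<subseteq> {a $ k..b $ k}"
    using assms(3) by (auto simp: mem_box_cart intro: order_trans)
  then have "continuous_on {a $ k..t $ k} ?g"
    using continuous_on_partial_pow_on_box[OF assms(1-3)]
    by (intro continuous_on_rabs) (rule continuous_on_subset)
  then obtain \<sigma> where \<sigma>: "\<sigma> \<in> {a $ k..t $ k}" "\<And>s. s \<in> {a $ k..t $ k} \<Longrightarrow> ?g s \<le> ?g \<sigma>"
    using continuous_attains_sup[of "{a $ k..t $ k}" ?g] assms(4) by auto
  then have "max_L a b k f p t = ?g \<sigma>"
    unfolding max_L_def by (intro Greatest_equality) auto
  then show ?thesis using \<sigma>(2)[OF assms(4)] by simp
qed

theorem theorem30:
  fixes a b t :: "real ^ 'm" and \<alpha> :: "'m \<Rightarrow> real \<Rightarrow> real" and x :: "real ^ 'm \<Rightarrow> real"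
    and k :: 'm and n N :: nat
  assumes "\<And>i. a $ i < b $ i"
    and "\<And>i s. s \<in> {a $ i..b $ i} \<Longrightarrow> \<alpha> i s \<in> {0<..<1}"
    and "n \<ge> 1"
    and "C_on_box (n + 1) a b x"
    and "N \<ge> n"
    and "t \<in> cbox a b"
    and "t $ k > a $ k"
  shows "caputo_III a b \<alpha> k x t =
      (\<Sum>p = 1..n. coeff_A n N (\<alpha> k (t $ k)) p * (t $ k - a $ k) powr (real p - \<alpha> k (t $ k)) *
                   partial_pow_on_box a b k p x t) +
      (\<Sum>p = n..N. coeff_B n (\<alpha> k (t $ k)) p *
                   (t $ k - a $ k) powr (real n - real p - \<alpha> k (t $ k)) *
                   moment_V a b k x n p t) +
      approx_error a b \<alpha> k x n N t
    \<and> approx_error a b \<alpha> k x n N t \<le>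
      max_L a b k x (n + 1) t *
      (exp ((real n - \<alpha> k (t $ k)) ^ 2 + real n - \<alpha> k (t $ k)) /
       (Gamma (real n + 1 - \<alpha> k (t $ k)) * real N powr (real n - \<alpha> k (t $ k)) *
        (real n - \<alpha> k (t $ k)))) *
      (t $ k - a $ k) powr (real n + 1 - \<alpha> k (t $ k))"
proof
  let ?al = "\<alpha> k (t $ k)"
  define F where "F = (\<lambda>p \<tau>. partial_pow_on_box a b k p x (upd_coord t k \<tau>))"
  have tk: "t $ k \<in> {a $ k..b $ k}"
    using assms(6) by (simp add: mem_box_cart)
  then have al: "0 < ?al" "?al < 1"
    using assms(2)[of "t $ k" k] by auto
  have sub: "{a $ k..t $ k} \<subseteq> {a $ k..b $ k}" using tk by auto
  have F: "(F p has_real_derivative F (Suc p) \<tau>) (at \<tau> within {a $ k..t $ k})"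
    if "p \<le> n" "\<tau> \<in> {a $ k..t $ k}" for p \<tau>
  proof -
    have "p < n + 1" "\<tau> \<in> {a $ k..b $ k}" using that sub by auto
    from partial_pow_on_box_deriv[OF assms(4) this(1) assms(6) this(2)] show ?thesis
      unfolding F_def by (rule has_field_derivative_subset) (rule sub)
  qed
  have cont: "continuous_on {a $ k..t $ k} (F (Suc n))"
    using continuous_on_partial_pow_on_box[OF assms(4) _ assms(6), of "Suc n" k]
    unfolding F_def by (rule continuous_on_subset[OF _ sub]) simp
  have "approx_error a b \<alpha> k x n N t =
      integral {a $ k..t $ k} (\<lambda>\<tau>. binomial_tail (N - n) ?al (a $ k) (t $ k) n \<tau> * F (Suc n) \<tau>)"
    using caputo_expansion[of "a $ k" "t $ k" ?al n N F, OF assms(7) al assms(3,5) F cont]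
    by (simp add: approx_error_def caputo_III_def moment_V_def F_def partial_pow_on_box_def)
  \<comment> \<open>The remainder estimate is two-sided; the claim is its upper half.\<close>
  also have "\<dots> \<le> \<bar>\<dots>\<bar>" by (rule abs_ge_self)
  also have "\<dots> \<le> max_L a b k x (n + 1) t *
      (exp ((real n - ?al) ^ 2 + real n - ?al) /
       (Gamma (real n + 1 - ?al) * real N powr (real n - ?al) * (real n - ?al))) *
      (t $ k - a $ k) powr (real n + 1 - ?al)"
    using abs_le_max_L[OF assms(4) _ assms(6)]
    by (intro caputo_remainder_bound assms al cont) (auto simp: F_def)
  finally show "approx_error a b \<alpha> k x n N t \<le> max_L a b k x (n + 1) t *
      (exp ((real n - ?al) ^ 2 + real n - ?al) /
       (Gamma (real n + 1 - ?al) * real N powr (real n - ?al) * (real n - ?al))) *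
      (t $ k - a $ k) powr (real n + 1 - ?al)" .
\<comment> \<open>The expansion itself holds by the definition of the error as a difference.\<close>
qed (simp add: approx_error_def)

end
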